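(* Let $t\ge 2$ and $n_1>n_2>\cdots>n_t\ge 3$ be integers and let $s_1,s_2,\ldots,s_t$ be positive integers. Consider the index vector $(n_1,\ldots,n_1,\ldots,n_t,\ldots,n_t)$ in which each $n_i$ appears exactly $s_i$ times. Let $B$ be a 3-element subset of $X_{n_1,\ldots,n_1,\ldots,n_t,\ldots,n_t}$ with $B\notin\mathcal{B}_{n_1,\ldots,n_1,\ldots,n_t,\ldots,n_t}$, and let $\mathcal{H}=(X_{n_1,\ldots,n_1,\ldots,n_t,\ldots,n_t},\ \mathcal{B}_{n_1,\ldots,n_1,\ldots,n_t,\ldots,n_t}\cup\{B\})$. Then $R(\mathcal{H})\ne R(\mathcal{H}_{n_1,\ldots,n_1,\ldots,n_t,\ldots,n_t})$.
   Context: For a positive integer $n$, $[n]=\{1,2,\ldots,n\}$. A bi-hypergraph $\mathcal{H}=(X,\mathcal{B})$ consists of a finite set $X$ of vertices and a family $\mathcal{B}$ of subsets of $X$, called bi-edges; it is 3-uniform if every bi-edge has exactly three elements. A proper $k$-coloring of $\mathcal{H}$ is a map from $X$ into a set of $k$ colors such that each bi-edge contains two vertices with a common color and also contains two vertices with distinct colors. A strict $k$-coloring is a proper $k$-coloring that uses all $k$ colors. $\overline{\chi}(\mathcal{H})$ is the largest $k$ such that $\mathcal{H}$ has a strict $k$-coloring. For each $k$, $r_k$ denotes the number of partitions of $X$ into $k$ nonempty color classes that arise from strict $k$-colorings of $\mathcal{H}$ (so colorings are counted up to renaming of colors). The chromatic spectrum is $R(\mathcal{H})=(r_1,r_2,\ldots,r_{\overline{\chi}})$;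 if $\mathcal{H}$ has no strict coloring at all, every $r_k$ is $0$ and $R(\mathcal{H})$ is the empty (zero) vector. Construction: for integers $m\ge 2$ and $a_1\ge a_2\ge\cdots\ge a_m\ge 3$, let $X_{a_1,\ldots,a_m}=\{(x_1,\ldots,x_m) : x_j\in[a_j],\ j\in[m]\}$ and let $\mathcal{B}_{a_1,\ldots,a_m}$ be the family of all sets $\{(x_1,\ldots,x_m),(y_1,\ldots,y_m),(z_1,\ldots,z_m)\}$ of three distinct elements of $X_{a_1,\ldots,a_m}$ such that $|\{x_j,y_j,z_j\}|=2$ for every $j\in[m]$. Then $\mathcal{H}_{a_1,\ldots,a_m}=(X_{a_1,\ldots,a_m},\mathcal{B}_{a_1,\ldots,a_m})$. *)

theory Defs
  imports Main
begin

record 'a bihypergraph =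
  vertices :: "'a set"
  biedges :: "'a set set"

definition wf_bihypergraph :: "'a bihypergraph \<Rightarrow> bool" where
  "wf_bihypergraph H \<longleftrightarrow> finite (vertices H) \<and> biedges H \<subseteq> Pow (vertices H)"

text \<open>The set of \<open>k\<close> colors is fixed to be \<open>{1..k}\<close>. Values of \<open>f\<close> outside the vertex set
  are irrelevant.\<close>

definition proper_coloring :: "'a bihypergraph \<Rightarrow> nat \<Rightarrow> ('a \<Rightarrow> nat) \<Rightarrow> bool" where
  "proper_coloring H k f \<longleftrightarrow>
     f ` vertices H \<subseteq> {1..k} \<and>
     (\<forall>E\<in>biedges H. (\<exists>u\<in>E. \<exists>v\<in>E. u \<noteq> v \<and> f u = f v) \<and> (\<exists>u\<in>E. \<exists>v\<in>E. f u \<noteq> f v))"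

definition strict_coloring :: "'a bihypergraph \<Rightarrow> nat \<Rightarrow> ('a \<Rightarrow> nat) \<Rightarrow> bool" where
  "strict_coloring H k f \<longleftrightarrow> proper_coloring H k f \<and> f ` vertices H = {1..k}"

definition strictly_colorable :: "'a bihypergraph \<Rightarrow> nat \<Rightarrow> bool" where
  "strictly_colorable H k \<longleftrightarrow> (\<exists>f. strict_coloring H k f)"

text \<open>Meaningful only if \<open>H\<close> has a finite vertex set and at least one strict coloring.\<close>

definition upper_chromatic_number :: "'a bihypergraph \<Rightarrow> nat" where
  "upper_chromatic_number H = Max {k. strictly_colorable H k}"

definition color_classes :: "'a bihypergraph \<Rightarrow> ('a \<Rightarrow> nat) \<Rightarrow> 'a set set" where
  "color_classes H f = {{x \<in> vertices H. f x = c} | c. c \<in> f ` vertices H}"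

definition num_strict_partitions :: "'a bihypergraph \<Rightarrow> nat \<Rightarrow> nat" where
  "num_strict_partitions H k = card {color_classes H f | f. strict_coloring H k f}"

text \<open>The vector \<open>(r\<^sub>1, r\<^sub>2, \<dots>)\<close> of length \<open>upper_chromatic_number H\<close>, hence \<open>r\<^sub>k\<close> is at list position
  \<open>k - 1\<close>; the empty vector if there is no strict coloring.\<close>

definition chromatic_spectrum :: "'a bihypergraph \<Rightarrow> nat list" where
  "chromatic_spectrum H =
     (if \<exists>k. strictly_colorable H k
      then map (num_strict_partitions H) [1..<Suc (upper_chromatic_number H)]
      else [])"

text \<open>The vector \<open>(a\<^sub>1, \<dots>, a\<^sub>m)\<close> and the tuples \<open>(x\<^sub>1, \<dots>, x\<^sub>m)\<close> are lists of length \<open>m\<close>, so the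
  \<open>j\<close>-th coordinate is at list position \<open>j - 1\<close>.\<close>

definition grid :: "nat list \<Rightarrow> nat list set" where
  "grid a = {x. length x = length a \<and> (\<forall>j<length a. x ! j \<in> {1..a ! j})}"

definition grid_biedges :: "nat list \<Rightarrow> nat list set set" where
  "grid_biedges a =
     {{x, y, z} | x y z. x \<in> grid a \<and> y \<in> grid a \<and> z \<in> grid a \<and>
        x \<noteq> y \<and> x \<noteq> z \<and> y \<noteq> z \<and>
        (\<forall>j<length a. card {x ! j, y ! j, z ! j} = 2)}"

definition grid_bihypergraph :: "nat list \<Rightarrow> nat list bihypergraph" where
  "grid_bihypergraph a = \<lparr>vertices = grid a, biedges = grid_biedges a\<rparr>"

text \<open>The vector \<open>(n\<^sub>1, \<dots>, n\<^sub>1, \<dots>, n\<^sub>t, \<dots>, n\<^sub>t)\<close> with \<open>s\<^sub>i\<close> consecutive entries \<open>n\<^sub>i\<close>.\<close>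

definition index_vector :: "nat \<Rightarrow> (nat \<Rightarrow> nat) \<Rightarrow> (nat \<Rightarrow> nat) \<Rightarrow> nat list" where
  "index_vector t n s = concat (map (\<lambda>i. replicate (s i) (n i)) [1..<Suc t])"

lemma finite_grid: "finite (grid a)"
proof (rule finite_subset)
  show "grid a \<subseteq> {x. set x \<subseteq> {..Max (set a)} \<and> length x = length a}"
  proof (clarsimp simp: grid_def)
    fix x y
    assume len: "length x = length a" and x: "\<forall>j<length a. Suc 0 \<le> x ! j \<and> x ! j \<le> a ! j"
      and "y \<in> set x"
    then obtain j where "j < length a" "y = x ! j"
      by (metis in_set_conv_nth)
    with x have "y \<le> a ! j" by blast
    also have "\<dots> \<le> Max (set a)" using \<open>j < length a\<close> by simp
    finally show "y \<le> Max (set a)" .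
  qed
  show "finite {x. set x \<subseteq> {..Max (set a)} \<and> length x = length a}"
    by (rule finite_lists_length_eq) simp
qed

lemma wf_grid_bihypergraph: "wf_bihypergraph (grid_bihypergraph a)"
  by (auto simp: wf_bihypergraph_def grid_bihypergraph_def finite_grid grid_biedges_def)

lemma wf_grid_bihypergraph_insert:
  assumes "B \<subseteq> grid a"
  shows "wf_bihypergraph \<lparr>vertices = grid a, biedges = grid_biedges a \<union> {B}\<rparr>"
  using assms wf_grid_bihypergraph[of a]
  by (auto simp: wf_bihypergraph_def grid_bihypergraph_def)

end

theory Submission
  imports Defs
begin

text \<open>
  For every coordinate \<open>j\<close>, the projection \<open>x \<mapsto> x ! j\<close> is a strict coloring of the grid with
  \<open>a ! j\<close> colors, because a bi-edge takes exactly two values in each coordinate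
  (\<open>strict_coloring_projection\<close>). A 3-set \<open>B\<close> of grid points fails to be a bi-edge exactly when it takes one or
  three values in some coordinate \<open>j\<close>, and then the projection to \<open>j\<close> colors \<open>B\<close> with a single color
  or with three distinct ones. So adding \<open>B\<close> destroys the partition of the grid that this projection
  induces.

  Adding bi-edges never creates a strict coloring, and whether a coloring is proper depends only on
  its color classes. The partitions counted by \<open>r\<^sub>k\<close> after the addition therefore form a
  subset of those counted before, and for \<open>k = a ! j\<close> the subset is proper. Hence
  \<open>r\<^sub>k\<close> drops strictly for that \<open>k\<close>, or \<open>k\<close> now exceeds the upper chromatic number; the
  spectrum changes in both cases (\<open>chromatic_spectrum_neq_if_coloring_lost\<close>).
\<close>

text \<open>Two vertices share a color iff they lie in a common class, so the classes recover the coloring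
  up to the names of the colors.\<close>

lemma color_eq_iff_if_color_classes_eq:
  assumes "color_classes H f = color_classes H g" "u \<in> vertices H" "v \<in> vertices H"
  shows "f u = f v \<longleftrightarrow> g u = g v"
proof -
  have "h u = h v \<longleftrightarrow> (\<exists>C\<in>color_classes H h. u \<in> C \<and> v \<in> C)" for h
    using assms(2,3) by (auto simp: color_classes_def)
  with assms(1) show ?thesis by simp
qed

lemma strict_coloring_cong_color_classes:
  assumes wf: "wf_bihypergraph H" and g: "strict_coloring H k g"
    and eq: "color_classes H f = color_classes H g" and f: "f ` vertices H = {1..k}"
  shows "strict_coloring H k f"
proof -
  have "(\<exists>u\<in>E. \<exists>v\<in>E. u \<noteq> v \<and> f u = f v) \<and> (\<exists>u\<in>E. \<exists>v\<in>E. f u \<noteq> f v)"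
    if E: "E \<in> biedges H" for E
  proof -
    have "E \<subseteq> vertices H" using wf E by (auto simp: wf_bihypergraph_def)
    then have same: "f u = f v \<longleftrightarrow> g u = g v" if "u \<in> E" "v \<in> E" for u v
      using color_eq_iff_if_color_classes_eq[OF eq] that by blast
    have "(\<exists>u\<in>E. \<exists>v\<in>E. u \<noteq> v \<and> g u = g v) \<and> (\<exists>u\<in>E. \<exists>v\<in>E. g u \<noteq> g v)"
      using g E by (auto simp: strict_coloring_def proper_coloring_def)
    then show ?thesis using same by blast
  qed
  with f show ?thesis by (auto simp: strict_coloring_def proper_coloring_def)
qed

lemma strict_coloring_mono:
  assumes "vertices H' = vertices H" "biedges H \<subseteq> biedges H'" "strict_coloring H' k f"
  shows "strict_coloring H k f"
  using assms by (auto simp: strict_coloring_def proper_coloring_def)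

lemma finite_strictly_colorable:
  assumes "finite (vertices H)"
  shows "finite {k. strictly_colorable H k}"
proof (rule finite_subset)
  show "{k. strictly_colorable H k} \<subseteq> {..card (vertices H)}"
  proof clarsimp
    fix k assume "strictly_colorable H k"
    then obtain f where "f ` vertices H = {1..k}"
      by (auto simp: strictly_colorable_def strict_coloring_def)
    then show "k \<le> card (vertices H)"
      using card_image_le[OF assms, of f] by simp
  qed
qed simp

text \<open>\<open>H'\<close> arises from \<open>H\<close> by adding bi-edges, and \<open>f\<close> is a coloring that does not survive. By the
  previous lemmas no recoloring with the same classes survives either, so the \<open>k\<close>-th entry
  of the spectrum cannot stay the same.\<close>

lemma chromatic_spectrum_neq_if_coloring_lost:
  assumes wf: "wf_bihypergraph H'"
    and V: "vertices H' = vertices H" and sub: "biedges H \<subseteq> biedges H'"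
    and f: "strict_coloring H k f" and lost: "\<not> strict_coloring H' k f" and "k \<ge> 1"
  shows "chromatic_spectrum H' \<noteq> chromatic_spectrum H"
proof
  assume eq: "chromatic_spectrum H' = chromatic_spectrum H"
  have fin: "finite (vertices H)" using wf V by (simp add: wf_bihypergraph_def)
  have col: "strictly_colorable H k" using f by (auto simp: strictly_colorable_def)
  then have k_le: "k \<le> upper_chromatic_number H"
    unfolding upper_chromatic_number_def
    using finite_strictly_colorable[OF fin] by (auto intro: Max_ge)
  have specH: "chromatic_spectrum H
      = map (num_strict_partitions H) [1..<Suc (upper_chromatic_number H)]"
    using col by (auto simp: chromatic_spectrum_def)
  (* Here k >= 1 matters: the spectrum of H is nonempty, so H' is strictly colorable too. *)
  have specH': "chromatic_spectrum H'
      = map (num_strict_partitions H') [1..<Suc (upper_chromatic_number H')]"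
    using eq specH k_le \<open>k \<ge> 1\<close> by (auto simp: chromatic_spectrum_def split: if_splits)
  have "length (chromatic_spectrum H') = length (chromatic_spectrum H)" using eq by simp
  then have "upper_chromatic_number H' = upper_chromatic_number H"
    by (simp add: specH specH' del: upt_Suc)
  then have "num_strict_partitions H' k = num_strict_partitions H k"
    using eq k_le \<open>k \<ge> 1\<close> by (auto simp: specH specH' simp del: upt_Suc)
  moreover have "num_strict_partitions H' k < num_strict_partitions H k"
    unfolding num_strict_partitions_def
  proof (rule psubset_card_mono)
    have classes: "color_classes H' g = color_classes H g" for g
      by (simp add: color_classes_def V)
    show "finite {color_classes H g |g. strict_coloring H k g}"
      by (rule finite_subset[of _ "Pow (Pow (vertices H))"])
        (use fin in \<open>auto simp: color_classes_def\<close>)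
    have "color_classes H f \<notin> {color_classes H' g |g. strict_coloring H' k g}"
    proof
      assume "color_classes H f \<in> {color_classes H' g |g. strict_coloring H' k g}"
      then obtain g where "strict_coloring H' k g" "color_classes H' f = color_classes H' g"
        by (auto simp: classes)
      moreover have "f ` vertices H' = {1..k}" using f V by (simp add: strict_coloring_def)
      ultimately show False using strict_coloring_cong_color_classes[OF wf] lost by blast
    qed
    moreover have "color_classes H f \<in> {color_classes H g |g. strict_coloring H k g}"
      using f by blast
    moreover have "{color_classes H' g |g. strict_coloring H' k g}
        \<subseteq> {color_classes H g |g. strict_coloring H k g}"
      using strict_coloring_mono[OF V sub] by (auto simp: classes)
    ultimately show "{color_classes H' g |g. strict_coloring H' k g}
        \<subset> {color_classes H g |g. strict_coloring H k g}" by blast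
  qed
  ultimately show False by simp
qed

text \<open>For a 3-set, being colored with exactly two colors is the same as having both a repeated
  color and two distinct ones; thus the bi-edges of the grid are the 3-sets properly
  colored by all coordinate projections.\<close>

lemma card_image_triple_eq_2_iff:
  assumes "x \<noteq> y" "x \<noteq> z" "y \<noteq> z"
  shows "card {f x, f y, f z} = 2 \<longleftrightarrow>
    (\<exists>u\<in>{x, y, z}. \<exists>v\<in>{x, y, z}. u \<noteq> v \<and> f u = f v) \<and>
    (\<exists>u\<in>{x, y, z}. \<exists>v\<in>{x, y, z}. f u \<noteq> f v)"
  using assms by (auto simp: card_insert_if)

lemma projection_image_grid:
  assumes "grid a \<noteq> {}" "j < length a"
  shows "(\<lambda>x. x ! j) ` grid a = {1..a ! j}"
proof
  show "(\<lambda>x. x ! j) ` grid a \<subseteq> {1..a ! j}" using assms(2) by (auto simp: grid_def)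
  obtain x where x: "x \<in> grid a" using assms(1) by blast
  show "{1..a ! j} \<subseteq> (\<lambda>x. x ! j) ` grid a"
  proof
    fix c assume "c \<in> {1..a ! j}"
    then have "x[j := c] \<in> grid a" "x[j := c] ! j = c"
      using x assms(2) by (auto simp: grid_def nth_list_update)
    then show "c \<in> (\<lambda>x. x ! j) ` grid a" by force
  qed
qed

lemma strict_coloring_projection:
  assumes "grid a \<noteq> {}" "j < length a"
  shows "strict_coloring (grid_bihypergraph a) (a ! j) (\<lambda>x. x ! j)"
proof -
  have "(\<exists>u\<in>E. \<exists>v\<in>E. u \<noteq> v \<and> u ! j = v ! j) \<and> (\<exists>u\<in>E. \<exists>v\<in>E. u ! j \<noteq> v ! j)"
    if "E \<in> grid_biedges a" for E
  proof -
    from that assms(2) obtain x y z where E: "E = {x, y, z}" "x \<noteq> y" "x \<noteq> z" "y \<noteq> z"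
      "card {x ! j, y ! j, z ! j} = 2"
      unfolding grid_biedges_def by blast
    then show ?thesis
      using card_image_triple_eq_2_iff[of x y z "\<lambda>x. x ! j"] by simp
  qed
  then show ?thesis
    using projection_image_grid[OF assms]
    by (simp add: strict_coloring_def proper_coloring_def grid_bihypergraph_def)
qed

lemma chromatic_spectrum_insert_non_biedge:
  assumes B: "B \<subseteq> grid a" "card B = 3" "B \<notin> grid_biedges a"
  shows "chromatic_spectrum \<lparr>vertices = grid a, biedges = grid_biedges a \<union> {B}\<rparr>
    \<noteq> chromatic_spectrum (grid_bihypergraph a)"
proof -
  obtain x y z where xyz: "B = {x, y, z}" "x \<noteq> y" "x \<noteq> z" "y \<noteq> z"
    using B(2) by (auto simp: card_3_iff)
  with B(1,3) obtain j where j: "j < length a" "card {x ! j, y ! j, z ! j} \<noteq> 2"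
    unfolding grid_biedges_def by blast
  have x: "x \<in> grid a" using B(1) xyz(1) by blast
  then have "a ! j \<ge> 1" using j(1) by (force simp: grid_def)
  moreover have "strict_coloring (grid_bihypergraph a) (a ! j) (\<lambda>x. x ! j)"
    using strict_coloring_projection x j(1) by blast
  moreover have "\<not> strict_coloring \<lparr>vertices = grid a, biedges = grid_biedges a \<union> {B}\<rparr>
      (a ! j) (\<lambda>x. x ! j)"
    using j(2) card_image_triple_eq_2_iff[OF xyz(2-4), of "\<lambda>x. x ! j"]
    unfolding strict_coloring_def proper_coloring_def xyz(1) by auto
  ultimately show ?thesis
    by (intro chromatic_spectrum_neq_if_coloring_lost wf_grid_bihypergraph_insert[OF B(1)])
      (auto simp: grid_bihypergraph_def)
qed

theorem theorem2p4:
  fixes t :: nat and n s :: "nat \<Rightarrow> nat" and B :: "nat list set"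
  assumes "t \<ge> 2"
    and "\<And>i. 1 \<le> i \<Longrightarrow> i < t \<Longrightarrow> n i > n (i + 1)"
    and "n t \<ge> 3"
    and "\<And>i. 1 \<le> i \<Longrightarrow> i \<le> t \<Longrightarrow> s i \<ge> 1"
    and "B \<subseteq> grid (index_vector t n s)"
    and "card B = 3"
    and "B \<notin> grid_biedges (index_vector t n s)"
  shows "chromatic_spectrum
           \<lparr>vertices = grid (index_vector t n s),
            biedges = grid_biedges (index_vector t n s) \<union> {B}\<rparr>
         \<noteq> chromatic_spectrum (grid_bihypergraph (index_vector t n s))"
  using assms(5-7) by (rule chromatic_spectrum_insert_non_biedge)

end
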